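(* Let $R$ be a finite commutative ring with identity, of order $n$, and let $k\ge 2$ be an integer. Then $$(1)\quad zp_k(R)\ \ge\ \frac{n^{k-1}+(n-|Z(R)|)\,|Ann_{k-1}(R)|+\sum_{x\in Z(R),\,x\ne 0}\left\{n^{k-1}-(n-|Ann(x)|)^{k-1}\right\}}{n^k},$$ $$(2)\quad zp_k(R)\ \le\ \frac{n^{k-1}+(n-|Z(R)|)\,|Ann_{k-1}(R)|+\sum_{x\in Z(R),\,x\ne 0}\left\{n^{k-1}-\big(n+(k-2)|Z(R)|-(k-1)|Ann(x)|\big)(n-|Z(R)|)^{k-2}\right\}}{n^k}.$$
   Context: All rings are nonzero finite commutative rings with identity. For an integer $k\ge 1$, $Ann_k(R)=\{(x_1,\dots,x_k)\in R^k : x_1x_2\cdots x_k=0\}$ (so $Ann_1(R)=\{0\}$), and for $k\ge 2$, $zp_k(R)=|Ann_k(R)|/|R|^k$. $Z(R)$ is the set of all zero divisors of $R$, including $0$. For $x\in R$, $Ann(x)=\{y\in R: xy=0\}$. *)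

theory Defs
  imports Complex_Main "HOL-Algebra.Coset" "HOL-Algebra.Ring"
begin

text \<open>Elements of \<open>R\<^sup>k\<close> are the extensional functions from \<open>{1..k}\<close> to the carrier.\<close>

definition ring_tuples :: "('a, 'm) ring_scheme \<Rightarrow> nat \<Rightarrow> (nat \<Rightarrow> 'a) set" where
  "ring_tuples R k = {1..k} \<rightarrow>\<^sub>E carrier R"

definition Ann_tuples :: "nat \<Rightarrow> ('a, 'm) ring_scheme \<Rightarrow> (nat \<Rightarrow> 'a) set" where
  "Ann_tuples k R = {x \<in> ring_tuples R k. (\<Otimes>\<^bsub>R\<^esub>i\<in>{1..k}. x i) = \<zero>\<^bsub>R\<^esub>}"

definition zp :: "nat \<Rightarrow> ('a, 'm) ring_scheme \<Rightarrow> real" where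
  "zp k R = real (card (Ann_tuples k R)) / real (order R) ^ k"

text \<open>In a nonzero ring, \<open>\<zero>\<close> belongs to this set.\<close>

definition zero_divisors :: "('a, 'm) ring_scheme \<Rightarrow> 'a set" where
  "zero_divisors R = {x \<in> carrier R. \<exists>y \<in> carrier R. y \<noteq> \<zero>\<^bsub>R\<^esub> \<and> x \<otimes>\<^bsub>R\<^esub> y = \<zero>\<^bsub>R\<^esub>}"

definition Ann :: "('a, 'm) ring_scheme \<Rightarrow> 'a \<Rightarrow> 'a set" where
  "Ann R x = {y \<in> carrier R. x \<otimes>\<^bsub>R\<^esub> y = \<zero>\<^bsub>R\<^esub>}"

end

theory Submission
  imports Defs
begin

text \<open>
  Split the tuples in \<open>Ann_tuples k R\<close> by their last entry \<open>x\<close>. What has to be counted is, for each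
  \<open>x\<close>, the number of \<open>(k - 1)\<close>-tuples whose product is annihilated by \<open>x\<close>
  (\<open>card_Ann_tuples_Suc\<close>). For \<open>x = \<zero>\<close> these are all tuples, and for a regular \<open>x\<close> they are the tuples
  with product \<open>\<zero>\<close>; this gives the two terms that both bounds share.

  Now let \<open>x\<close> be a nonzero zero divisor, and look at the complement, the tuples \<open>y\<close> with
  \<open>x \<cdot> y\<^sub>1 \<cdots> y\<^sub>m \<noteq> \<zero>\<close>. No entry of such a tuple is in the annihilator of \<open>x\<close>, so there are at most
  \<open>(n - |Ann x|)\<^sup>m\<close> of them, which is the lower bound. Conversely, multiplying by a regular element
  does not annihilate anything nonzero, so the complement contains every tuple of regular elements
  and every tuple with exactly one zero divisor, as long as that zero divisor does not annihilate
  \<open>x\<close>. Since \<open>Ann x\<close> consists of zero divisors, there are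
  \<open>(n - |Z|)\<^sup>m + m (|Z| - |Ann x|) (n - |Z|)\<^bsup>m-1\<^esup>\<close> tuples of these two kinds; for \<open>m = k - 1\<close> this is
  the product that is subtracted in the upper bound.
\<close>

section \<open>Zero divisors and regular elements\<close>

definition tuples_killed_by :: "('a, 'm) ring_scheme \<Rightarrow> nat \<Rightarrow> 'a \<Rightarrow> (nat \<Rightarrow> 'a) set" where
  "tuples_killed_by R m x = {y \<in> ring_tuples R m. x \<otimes>\<^bsub>R\<^esub> (\<Otimes>\<^bsub>R\<^esub>i\<in>{1..m}. y i) = \<zero>\<^bsub>R\<^esub>}"

lemma ring_tuples_mem: "y \<in> ring_tuples R m \<Longrightarrow> i \<in> {1..m} \<Longrightarrow> y i \<in> carrier R"
  by (auto simp: ring_tuples_def)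

lemma finite_ring_tuples: "finite (carrier R) \<Longrightarrow> finite (ring_tuples R m)"
  by (simp add: ring_tuples_def finite_PiE)

lemma card_ring_tuples: "card (ring_tuples R m) = order R ^ m"
  by (simp add: ring_tuples_def card_PiE order_def)

lemma zero_divisors_subset: "zero_divisors R \<subseteq> carrier R"
  by (auto simp: zero_divisors_def)

context cring
begin

lemma zero_in_zero_divisors: "\<one> \<noteq> \<zero> \<Longrightarrow> \<zero> \<in> zero_divisors R"
  by (auto simp: zero_divisors_def intro!: bexI[of _ \<one>])

lemma Ann_subset_zero_divisors:
  assumes "x \<in> carrier R" "x \<noteq> \<zero>"
  shows "Ann R x \<subseteq> zero_divisors R"
  using assms by (auto simp: Ann_def zero_divisors_def m_comm intro!: bexI[of _ x])

lemma regular_mult_neq_zero: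
  assumes "r \<in> carrier R - zero_divisors R" "b \<in> carrier R" "b \<noteq> \<zero>"
  shows "r \<otimes> b \<noteq> \<zero>"
  using assms by (auto simp: zero_divisors_def)

lemma mult_finprod_regular_neq_zero:
  assumes "finite I" "b \<in> carrier R" "b \<noteq> \<zero>"
    and "\<And>i. i \<in> I \<Longrightarrow> y i \<in> carrier R - zero_divisors R"
  shows "b \<otimes> (\<Otimes>i\<in>I. y i) \<noteq> \<zero>"
  using assms(1,4)
proof (induction I)
  case empty
  then show ?case using assms by simp
next
  case (insert i I)
  have y: "y \<in> I \<rightarrow> carrier R" "y i \<in> carrier R"
    using insert.prems by auto
  have "b \<otimes> (\<Otimes>j\<in>insert i I. y j) = y i \<otimes> (b \<otimes> (\<Otimes>j\<in>I. y j))"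
    using insert y assms(2) by (simp add: m_lcomm)
  moreover have "y i \<otimes> (b \<otimes> (\<Otimes>j\<in>I. y j)) \<noteq> \<zero>"
  proof (rule regular_mult_neq_zero)
    show "y i \<in> carrier R - zero_divisors R" using insert.prems by blast
    show "b \<otimes> (\<Otimes>j\<in>I. y j) \<in> carrier R" using y assms(2) by simp
    show "b \<otimes> (\<Otimes>j\<in>I. y j) \<noteq> \<zero>" using insert by blast
  qed
  ultimately show ?case by simp
qed

lemma finprod_split_off:
  assumes "finite I" "j \<in> I" "y \<in> I \<rightarrow> carrier R"
  shows "(\<Otimes>i\<in>I. y i) = y j \<otimes> (\<Otimes>i\<in>I - {j}. y i)"
proof -
  have "(\<Otimes>i\<in>insert j (I - {j}). y i) = y j \<otimes> (\<Otimes>i\<in>I - {j}. y i)"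
    using assms by (intro finprod_insert) auto
  then show ?thesis using assms(2) by (simp add: insert_absorb)
qed

section \<open>Splitting off the last entry\<close>

text \<open>
  Appending an entry \<open>x\<close> to a tuple killed by \<open>x\<close> is a bijection onto the tuples with product \<open>\<zero>\<close>.
\<close>

lemma card_Ann_tuples_Suc:
  assumes fin: "finite (carrier R)"
  shows "card (Ann_tuples (Suc m) R) = (\<Sum>x\<in>carrier R. card (tuples_killed_by R m x))"
proof -
  have prod_Suc: "(\<Otimes>i\<in>{1..Suc m}. f i) = f (Suc m) \<otimes> (\<Otimes>i\<in>{1..m}. f i)"
    if "f \<in> {1..Suc m} \<rightarrow> carrier R" for f
  proof -
    have "{1..Suc m} - {Suc m} = {1..m}" by auto
    then show ?thesis using finprod_split_off[of "{1..Suc m}" "Suc m" f] that by simp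
  qed
  let ?S = "SIGMA x:carrier R. tuples_killed_by R m x"
  have "bij_betw (\<lambda>(x, y). y(Suc m := x)) ?S (Ann_tuples (Suc m) R)"
  proof (rule bij_betwI[where g = "\<lambda>f. (f (Suc m), restrict f {1..m})"])
    show "(\<lambda>(x, y). y(Suc m := x)) \<in> ?S \<rightarrow> Ann_tuples (Suc m) R"
    proof clarify
      fix x y assume x: "x \<in> carrier R" and y: "y \<in> tuples_killed_by R m x"
      let ?f = "y(Suc m := x)"
      have y': "y \<in> {1..m} \<rightarrow>\<^sub>E carrier R"
        using y by (simp add: tuples_killed_by_def ring_tuples_def)
      have f: "?f \<in> {1..Suc m} \<rightarrow>\<^sub>E carrier R"
        using x y' by (auto simp: PiE_iff extensional_def Ball_def le_Suc_eq)
      have "(\<Otimes>i\<in>{1..m}. ?f i) = (\<Otimes>i\<in>{1..m}. y i)"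
        using y' by (intro finprod_cong') auto
      moreover have "(\<Otimes>i\<in>{1..Suc m}. ?f i) = ?f (Suc m) \<otimes> (\<Otimes>i\<in>{1..m}. ?f i)"
        using f unfolding PiE_def by (intro prod_Suc) (rule IntD1)
      ultimately have "(\<Otimes>i\<in>{1..Suc m}. ?f i) = x \<otimes> (\<Otimes>i\<in>{1..m}. y i)"
        by (simp only: fun_upd_same)
      then show "?f \<in> Ann_tuples (Suc m) R"
        using f y unfolding Ann_tuples_def ring_tuples_def tuples_killed_by_def mem_Collect_eq
        by (simp only: simp_thms)
    qed
    show "(\<lambda>f. (f (Suc m), restrict f {1..m})) \<in> Ann_tuples (Suc m) R \<rightarrow> ?S"
    proof
      fix f assume "f \<in> Ann_tuples (Suc m) R"
      then have f: "f \<in> {1..Suc m} \<rightarrow>\<^sub>E carrier R" and 0: "(\<Otimes>i\<in>{1..Suc m}. f i) = \<zero>"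
        by (auto simp: Ann_tuples_def ring_tuples_def)
      have "(\<Otimes>i\<in>{1..m}. restrict f {1..m} i) = (\<Otimes>i\<in>{1..m}. f i)"
        using f by (intro finprod_cong') auto
      then have "f (Suc m) \<otimes> (\<Otimes>i\<in>{1..m}. restrict f {1..m} i) = \<zero>"
        using prod_Suc[of f] f 0 by (auto simp: PiE_def)
      moreover have "f (Suc m) \<in> carrier R" "restrict f {1..m} \<in> ring_tuples R m"
        using f by (auto simp: ring_tuples_def)
      ultimately show "(f (Suc m), restrict f {1..m}) \<in> ?S"
        unfolding tuples_killed_by_def by blast
    qed
  next
    fix p assume "p \<in> ?S"
    then show "(\<lambda>f. (f (Suc m), restrict f {1..m})) ((\<lambda>(x, y). y(Suc m := x)) p) = p"
      by (auto simp: tuples_killed_by_def ring_tuples_def PiE_iff extensional_def fun_eq_iff)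
  next
    fix f assume "f \<in> Ann_tuples (Suc m) R"
    then have "f \<in> {1..Suc m} \<rightarrow>\<^sub>E carrier R"
      by (simp add: Ann_tuples_def ring_tuples_def)
    then show "(\<lambda>(x, y). y(Suc m := x)) (f (Suc m), restrict f {1..m}) = f"
      by (auto simp: PiE_iff extensional_def fun_eq_iff le_Suc_eq)
  qed
  then have "card (Ann_tuples (Suc m) R) = card ?S"
    by (simp add: bij_betw_same_card)
  also have "\<dots> = (\<Sum>x\<in>carrier R. card (tuples_killed_by R m x))"
    using fin finite_ring_tuples[OF fin]
    by (intro card_SigmaI) (auto simp: tuples_killed_by_def)
  finally show ?thesis .
qed

lemma tuples_killed_by_zero: "tuples_killed_by R m \<zero> = ring_tuples R m"
proof -
  have "\<zero> \<otimes> (\<Otimes>i\<in>{1..m}. y i) = \<zero>" if "y \<in> ring_tuples R m" for y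
    using ring_tuples_mem[OF that] by (intro l_null finprod_closed) auto
  then show ?thesis by (auto simp: tuples_killed_by_def)
qed

lemma tuples_killed_by_regular:
  assumes "x \<in> carrier R - zero_divisors R"
  shows "tuples_killed_by R m x = Ann_tuples m R"
proof -
  have "x \<otimes> (\<Otimes>i\<in>{1..m}. y i) = \<zero> \<longleftrightarrow> (\<Otimes>i\<in>{1..m}. y i) = \<zero>"
    if "y \<in> ring_tuples R m" for y
  proof -
    have "(\<Otimes>i\<in>{1..m}. y i) \<in> carrier R"
      using ring_tuples_mem[OF that] by (intro finprod_closed) auto
    then show ?thesis using regular_mult_neq_zero[OF assms] assms by auto
  qed
  then show ?thesis by (auto simp: tuples_killed_by_def Ann_tuples_def)
qed

section \<open>Bounds for a single nonzero zero divisor\<close>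

lemma real_card_diff:
  assumes "finite B" "A \<subseteq> B"
  shows "real (card (B - A)) = real (card B) - real (card A)"
  using assms by (simp add: card_Diff_subset finite_subset card_mono of_nat_diff)

lemma card_killed_eq_complement:
  assumes "finite (carrier R)"
  shows "real (card (tuples_killed_by R m x)) =
    real (order R) ^ m - real (card (ring_tuples R m - tuples_killed_by R m x))"
  using real_card_diff[OF finite_ring_tuples[OF assms], of "tuples_killed_by R m x" m]
  by (auto simp: tuples_killed_by_def card_ring_tuples)

text \<open>
  A single entry that annihilates \<open>x\<close> kills the whole product, so tuples outside
  \<open>tuples_killed_by R m x\<close> avoid \<open>Ann R x\<close> in every entry.
\<close>

lemma card_tuples_killed_by_ge:
  assumes fin: "finite (carrier R)" and x: "x \<in> carrier R"
  shows "real (card (tuples_killed_by R m x)) \<ge>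
    real (order R) ^ m - (real (order R) - real (card (Ann R x))) ^ m"
proof -
  let ?P = "{1..m} \<rightarrow>\<^sub>E (carrier R - Ann R x)"
  have "ring_tuples R m - tuples_killed_by R m x \<subseteq> ?P"
  proof
    fix y assume y: "y \<in> ring_tuples R m - tuples_killed_by R m x"
    have "y j \<notin> Ann R x" if j: "j \<in> {1..m}" for j
    proof
      assume "y j \<in> Ann R x"
      then have yj: "y j \<in> carrier R" "x \<otimes> y j = \<zero>" by (auto simp: Ann_def)
      have c: "y \<in> {1..m} \<rightarrow> carrier R" using y by (auto intro: ring_tuples_mem)
      have c': "(\<Otimes>i\<in>{1..m} - {j}. y i) \<in> carrier R"
        using c by (intro finprod_closed) auto
      have "x \<otimes> (\<Otimes>i\<in>{1..m}. y i) = (x \<otimes> y j) \<otimes> (\<Otimes>i\<in>{1..m} - {j}. y i)"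
        using finprod_split_off[OF _ j c] c' x yj(1) by (simp add: m_assoc)
      also have "\<dots> = \<zero>" using yj c' by simp
      finally show False using y by (simp add: tuples_killed_by_def)
    qed
    then show "y \<in> ?P" using y by (auto simp: ring_tuples_def PiE_iff)
  qed
  then have "card (ring_tuples R m - tuples_killed_by R m x) \<le> card ?P"
    using fin by (intro card_mono) (auto intro: finite_PiE)
  then have "real (card (ring_tuples R m - tuples_killed_by R m x))
      \<le> real (card (carrier R - Ann R x)) ^ m"
    by (simp add: card_PiE flip: of_nat_power)
  moreover have "real (card (carrier R - Ann R x)) = real (order R) - real (card (Ann R x))"
    unfolding order_def using fin by (intro real_card_diff) (auto simp: Ann_def)
  ultimately show ?thesis using card_killed_eq_complement[OF fin, of m x] by simp
qed

text \<open>
  A nonzero element stays nonzero under multiplication by regular elements. Hence \<open>x\<close> kills no tuple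
  of regular elements, and no tuple with a single zero divisor \<open>z\<close> such that \<open>x \<otimes> z \<noteq> \<zero>\<close>. The
  subtracted product is the number of tuples of these two kinds.
\<close>

lemma card_tuples_killed_by_le:
  assumes fin: "finite (carrier R)" and x: "x \<in> carrier R" "x \<noteq> \<zero>" and m: "m \<ge> 1"
  shows "real (card (tuples_killed_by R m x)) \<le> real (order R) ^ m
    - (real (order R) + (real m - 1) * real (card (zero_divisors R))
        - real m * real (card (Ann R x)))
      * (real (order R) - real (card (zero_divisors R))) ^ (m - 1)"
proof -
  let ?Z = "zero_divisors R"
  let ?G = "carrier R - ?Z"
  let ?D = "?Z - Ann R x"
  \<comment> \<open>\<open>A\<close> has the tuples without zero divisors, \<open>B j\<close> those whose only zero divisor is in position
    \<open>j\<close> and does not annihilate \<open>x\<close>.\<close>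
  define A where "A = {1..m} \<rightarrow>\<^sub>E ?G"
  define B where "B j = (\<Pi>\<^sub>E i\<in>{1..m}. if i = j then ?D else ?G)" for j
  have finZ: "finite ?Z" using finite_subset[OF zero_divisors_subset fin] .
  have finA: "finite A" using fin unfolding A_def by (intro finite_PiE) auto
  have finB: "finite (B j)" for j
    using fin finZ unfolding B_def by (intro finite_PiE) auto
  have cardA: "card A = card ?G ^ m" by (simp add: A_def card_PiE)
  have cardB: "card (B j) = card ?D * card ?G ^ (m - 1)" if "j \<in> {1..m}" for j
  proof -
    have "card (B j) = (\<Prod>i\<in>{1..m}. card (if i = j then ?D else ?G))"
      by (simp add: B_def card_PiE)
    also have "\<dots> = card ?D * (\<Prod>i\<in>{1..m} - {j}. card (if i = j then ?D else ?G))"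
      using that by (subst prod.remove[of _ j]) auto
    also have "(\<Prod>i\<in>{1..m} - {j}. card (if i = j then ?D else ?G)) = (\<Prod>i\<in>{1..m} - {j}. card ?G)"
      by (intro prod.cong) auto
    finally show ?thesis using that by simp
  qed
  have B_mem: "y j \<in> ?D" "i \<in> {1..m} \<Longrightarrow> i \<noteq> j \<Longrightarrow> y i \<in> ?G"
    if "y \<in> B j" "j \<in> {1..m}" for y i j
    using that PiE_mem[of y "{1..m}" "\<lambda>i. if i = j then ?D else ?G"]
    by (auto simp: B_def split: if_splits)
  have disjB: "B i \<inter> B j = {}" if "i \<in> {1..m}" "j \<in> {1..m}" "i \<noteq> j" for i j
    using B_mem[of _ i] B_mem[of _ j] that by blast
  have disjAB: "A \<inter> (\<Union>j\<in>{1..m}. B j) = {}"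
    using B_mem(1) by (fastforce simp: A_def PiE_iff)
  have "card (A \<union> (\<Union>j\<in>{1..m}. B j)) = card A + card (\<Union>j\<in>{1..m}. B j)"
    using finA finB disjAB by (intro card_Un_disjoint) auto
  also have "card (\<Union>j\<in>{1..m}. B j) = (\<Sum>j\<in>{1..m}. card (B j))"
    using finB disjB by (intro card_UN_disjoint) auto
  also have "\<dots> = m * (card ?D * card ?G ^ (m - 1))"
    using cardB by simp
  finally have count: "card (A \<union> (\<Union>j\<in>{1..m}. B j))
      = card ?G ^ m + m * (card ?D * card ?G ^ (m - 1))"
    by (simp add: cardA)

  have "A \<subseteq> ring_tuples R m - tuples_killed_by R m x"
  proof
    fix y assume y: "y \<in> A"
    then have "x \<otimes> (\<Otimes>i\<in>{1..m}. y i) \<noteq> \<zero>"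
      using x by (intro mult_finprod_regular_neq_zero) (auto simp: A_def)
    then show "y \<in> ring_tuples R m - tuples_killed_by R m x"
      using y by (auto simp: tuples_killed_by_def A_def ring_tuples_def PiE_iff)
  qed
  moreover have "B j \<subseteq> ring_tuples R m - tuples_killed_by R m x" if j: "j \<in> {1..m}" for j
  proof
    fix y assume y: "y \<in> B j"
    note mem = B_mem[OF y j]
    have "y j \<in> carrier R"
      using mem(1) zero_divisors_subset[of R] by blast
    then have yj: "y j \<in> carrier R" "x \<otimes> y j \<noteq> \<zero>"
      using mem(1) by (auto simp: Ann_def)
    have c: "y \<in> {1..m} \<rightarrow> carrier R"
    proof
      fix i assume "i \<in> {1..m}"
      then show "y i \<in> carrier R" using mem(2)[of i] yj by (cases "i = j") auto
    qed
    have c': "(\<Otimes>i\<in>{1..m} - {j}. y i) \<in> carrier R"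
      using c by (intro finprod_closed) auto
    have "x \<otimes> (\<Otimes>i\<in>{1..m}. y i) = (x \<otimes> y j) \<otimes> (\<Otimes>i\<in>{1..m} - {j}. y i)"
      using finprod_split_off[OF _ j c] c' x yj(1) by (simp add: m_assoc)
    moreover have "(x \<otimes> y j) \<otimes> (\<Otimes>i\<in>{1..m} - {j}. y i) \<noteq> \<zero>"
      using x yj mem(2) by (intro mult_finprod_regular_neq_zero) auto
    moreover have "y \<in> ring_tuples R m"
      using y c by (auto simp: B_def ring_tuples_def PiE_def)
    ultimately show "y \<in> ring_tuples R m - tuples_killed_by R m x"
      by (simp add: tuples_killed_by_def)
  qed
  ultimately have "A \<union> (\<Union>j\<in>{1..m}. B j) \<subseteq> ring_tuples R m - tuples_killed_by R m x"
    by blast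
  then have "card (A \<union> (\<Union>j\<in>{1..m}. B j)) \<le> card (ring_tuples R m - tuples_killed_by R m x)"
    using finite_ring_tuples[OF fin] by (intro card_mono) auto
  then have le: "real (card ?G) ^ m + real m * (real (card ?D) * real (card ?G) ^ (m - 1))
      \<le> real (card (ring_tuples R m - tuples_killed_by R m x))"
    unfolding count by (metis of_nat_le_iff of_nat_add of_nat_mult of_nat_power)
  have G: "real (card ?G) = real (order R) - real (card ?Z)"
    unfolding order_def by (rule real_card_diff[OF fin zero_divisors_subset])
  have D: "real (card ?D) = real (card ?Z) - real (card (Ann R x))"
    by (rule real_card_diff[OF finZ Ann_subset_zero_divisors[OF x]])
  have "real (card ?G) ^ m = real (card ?G) * real (card ?G) ^ (m - 1)"
    using m by (simp flip: power_Suc)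
  then have "real (card ?G) ^ m + real m * (real (card ?D) * real (card ?G) ^ (m - 1))
    = (real (order R) + (real m - 1) * real (card ?Z) - real m * real (card (Ann R x)))
      * (real (order R) - real (card ?Z)) ^ (m - 1)"
    unfolding G D by (simp add: algebra_simps)
  then show ?thesis using le card_killed_eq_complement[OF fin, of m x] by simp
qed

section \<open>The bounds for the probability of a zero product\<close>

text \<open>
  The first summand is the contribution of the last entry \<open>\<zero>\<close>, the second that of all regular last
  entries.
\<close>

lemma card_Ann_tuples_decomposition:
  assumes fin: "finite (carrier R)" and "\<one> \<noteq> \<zero>"
  shows "real (card (Ann_tuples (Suc m) R)) = real (order R) ^ m
    + (real (order R) - real (card (zero_divisors R))) * real (card (Ann_tuples m R))
    + (\<Sum>x\<in>zero_divisors R - {\<zero>}. real (card (tuples_killed_by R m x)))"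
proof -
  let ?Z = "zero_divisors R"
  let ?N = "\<lambda>x. real (card (tuples_killed_by R m x))"
  have "real (card (Ann_tuples (Suc m) R)) = (\<Sum>x\<in>carrier R. ?N x)"
    by (simp add: card_Ann_tuples_Suc[OF fin])
  also have "\<dots> = (\<Sum>x\<in>carrier R - ?Z. ?N x) + (\<Sum>x\<in>?Z. ?N x)"
    using sum.subset_diff[OF zero_divisors_subset fin] .
  also have "(\<Sum>x\<in>carrier R - ?Z. ?N x) = (\<Sum>x\<in>carrier R - ?Z. real (card (Ann_tuples m R)))"
    by (intro sum.cong) (simp_all add: tuples_killed_by_regular)
  also have "\<dots> = (real (order R) - real (card ?Z)) * real (card (Ann_tuples m R))"
    using real_card_diff[OF fin zero_divisors_subset] by (simp add: order_def)
  also have "(\<Sum>x\<in>?Z. ?N x) = ?N \<zero> + (\<Sum>x\<in>?Z - {\<zero>}. ?N x)"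
    using zero_in_zero_divisors[OF assms(2)] finite_subset[OF zero_divisors_subset fin]
    by (simp add: sum.remove)
  also have "?N \<zero> = real (order R) ^ m"
    by (simp add: tuples_killed_by_zero card_ring_tuples)
  finally show ?thesis by simp
qed

end

theorem theorem2p2:
  fixes R :: "('a, 'm) ring_scheme" and n k :: nat
  assumes "cring R"
    and "finite (carrier R)"
    and "\<one>\<^bsub>R\<^esub> \<noteq> \<zero>\<^bsub>R\<^esub>"
    and "order R = n"
    and "k \<ge> 2"
  shows "zp k R \<ge>
      (real n ^ (k - 1)
        + (real n - real (card (zero_divisors R))) * real (card (Ann_tuples (k - 1) R))
        + (\<Sum>x \<in> zero_divisors R - {\<zero>\<^bsub>R\<^esub>}.
            real n ^ (k - 1) - (real n - real (card (Ann R x))) ^ (k - 1)))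
      / real n ^ k
    \<and> zp k R \<le>
      (real n ^ (k - 1)
        + (real n - real (card (zero_divisors R))) * real (card (Ann_tuples (k - 1) R))
        + (\<Sum>x \<in> zero_divisors R - {\<zero>\<^bsub>R\<^esub>}.
            real n ^ (k - 1)
            - (real n + (real k - 2) * real (card (zero_divisors R))
                - (real k - 1) * real (card (Ann R x)))
              * (real n - real (card (zero_divisors R))) ^ (k - 2)))
      / real n ^ k"
proof -
  interpret cring R by fact
  note fin = \<open>finite (carrier R)\<close>
  obtain m where m: "k = Suc m" "m \<ge> 1"
    using \<open>k \<ge> 2\<close> by (cases k) auto
  have mem: "x \<in> carrier R" "x \<noteq> \<zero>\<^bsub>R\<^esub>" if "x \<in> zero_divisors R - {\<zero>\<^bsub>R\<^esub>}" for x
    using that subsetD[OF zero_divisors_subset] by auto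
  have k: "k - 1 = m" "k - 2 = m - 1" "real k - 1 = real m" "real k - 2 = real m - 1"
    using m by auto
  note dec = card_Ann_tuples_decomposition[OF fin \<open>\<one>\<^bsub>R\<^esub> \<noteq> \<zero>\<^bsub>R\<^esub>\<close>, of m, folded m(1)]
  show ?thesis
    unfolding zp_def dec k \<open>order R = n\<close>
  proof (intro conjI divide_right_mono add_left_mono sum_mono)
    fix x assume "x \<in> zero_divisors R - {\<zero>\<^bsub>R\<^esub>}"
    note x = mem[OF this]
    show "real n ^ m - (real n - real (card (Ann R x))) ^ m
        \<le> real (card (tuples_killed_by R m x))"
      using card_tuples_killed_by_ge[OF fin x(1)] \<open>order R = n\<close> by simp
    show "real (card (tuples_killed_by R m x)) \<le> real n ^ m
        - (real n + (real m - 1) * real (card (zero_divisors R)) - real m * real (card (Ann R x)))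
          * (real n - real (card (zero_divisors R))) ^ (m - 1)"
      using card_tuples_killed_by_le[OF fin x m(2)] \<open>order R = n\<close> by simp
  qed simp_all
qed

end
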